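(* Let $L_2$ be the 2-tape language over the alphabet $\Sigma=\{1,\nabla\}$ given by $$L_2=\{(x_1\nabla x_2\nabla x_3,\;y)\;:\;x_1,x_2,x_3,y\in\{1\}^*,\ \text{exactly two of the indices } j\in\{1,2,3\}\text{ satisfy } x_j=y\}.$$ There exists a probabilistic 2-tape finite automaton which recognizes $L_2$ with probability $\frac{21}{40}$.
   Context: A 2-tape language over $\Sigma$ is a set of pairs of words $L\subseteq\Sigma^*\times\Sigma^*$ (first component: content of tape 1; second component: content of tape 2). A probabilistic 2-tape finite automaton is a one-way two-tape machine with finitely many states, one of them initial, and some of them designated as accepting or rejecting halting states. Tape $i$ holds the input word $x^i$ between endmarkers, $\kappa x^i\$$, with one read-only head per tape starting on $\kappa$. In each step, depending on the current state and the pair of scanned symbols, it chooses at random (according to a fixed probability distribution depending only on these data) a new state and, for each head, whether it stays or moves one cell to the right; heads never move left or beyond $\$$. On entering a halting state the computation stops and the input is accepted or rejected accordingly. An automaton recognizes $L$ with probability $p$ if every input in $L$ is accepted with probability at least $p$ and every input not in $L$ is rejected with probability at least $p$. *)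

theory Defs
  imports "HOL-Probability.Probability"
begin

datatype 'a tape_symbol = LeftEnd | Letter 'a | RightEnd

definition tape :: "'a list \<Rightarrow> 'a tape_symbol list" where
  "tape x = LeftEnd # map Letter x @ [RightEnd]"

text \<open>
  In a transition \<open>(q, m1, m2)\<close>, the Boolean \<open>mi\<close> says whether head \<open>i\<close> moves
  one cell to the right (true) or stays (false).
\<close>

record ('q, 'a) automaton2 =
  states :: "'q set"
  init :: 'q
  acc :: "'q set"
  rej :: "'q set"
  trans :: "'q \<Rightarrow> 'a tape_symbol \<Rightarrow> 'a tape_symbol \<Rightarrow> ('q \<times> bool \<times> bool) pmf"

definition prob_2tape_automaton :: "('q, 'a) automaton2 \<Rightarrow> bool" where
  "prob_2tape_automaton M \<longleftrightarrow>
     finite (states M) \<and> init M \<in> states M \<and>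
     acc M \<subseteq> states M \<and> rej M \<subseteq> states M \<and> acc M \<inter> rej M = {} \<and>
     (\<forall>q \<in> states M - (acc M \<union> rej M). \<forall>a b. \<forall>(q', m1, m2) \<in> set_pmf (trans M q a b).
        q' \<in> states M \<and> (a = RightEnd \<longrightarrow> \<not> m1) \<and> (b = RightEnd \<longrightarrow> \<not> m2))"

text \<open>
  A configuration consists of the state and the positions of the two heads, where
  position \<open>0\<close> carries the left endmarker. Halting configurations are absorbing.
\<close>

definition step :: "('q, 'a) automaton2 \<Rightarrow> 'a list \<Rightarrow> 'a list \<Rightarrow> 'q \<times> nat \<times> nat \<Rightarrow> ('q \<times> nat \<times> nat) pmf" where
  "step M x y = (\<lambda>(q, i, j).
     if q \<in> acc M \<union> rej M then return_pmf (q, i, j)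
     else map_pmf (\<lambda>(q', m1, m2). (q', i + of_bool m1, j + of_bool m2))
            (trans M q (tape x ! i) (tape y ! j)))"

primrec run :: "('q, 'a) automaton2 \<Rightarrow> 'a list \<Rightarrow> 'a list \<Rightarrow> nat \<Rightarrow> ('q \<times> nat \<times> nat) pmf" where
  "run M x y 0 = return_pmf (init M, 0, 0)"
| "run M x y (Suc n) = bind_pmf (run M x y n) (step M x y)"

text \<open>
  As halting configurations are absorbing, the probability of having accepted within
  \<open>n\<close> steps is nondecreasing in \<open>n\<close>; its supremum is the probability that the
  computation ever accepts, and likewise for rejection. Computations that never halt
  count towards neither.
\<close>

definition accept_prob :: "('q, 'a) automaton2 \<Rightarrow> 'a list \<Rightarrow> 'a list \<Rightarrow> real" where
  "accept_prob M x y = (SUP n. measure_pmf.prob (run M x y n) {(q, i, j). q \<in> acc M})"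

definition reject_prob :: "('q, 'a) automaton2 \<Rightarrow> 'a list \<Rightarrow> 'a list \<Rightarrow> real" where
  "reject_prob M x y = (SUP n. measure_pmf.prob (run M x y n) {(q, i, j). q \<in> rej M})"

definition recognizes :: "('q, 'a) automaton2 \<Rightarrow> ('a list \<times> 'a list) set \<Rightarrow> real \<Rightarrow> bool" where
  "recognizes M L p \<longleftrightarrow>
     (\<forall>x y. ((x, y) \<in> L \<longrightarrow> accept_prob M x y \<ge> p) \<and>
            ((x, y) \<notin> L \<longrightarrow> reject_prob M x y \<ge> p))"

datatype letter = One | Nabla

definition L2 :: "(letter list \<times> letter list) set" where
  "L2 = {(x 1 @ [Nabla] @ x 2 @ [Nabla] @ x 3, y) | (x :: nat \<Rightarrow> letter list) y.
           (\<forall>j \<in> {1, 2, 3}. x j \<in> lists {One}) \<and> y \<in> lists {One} \<and>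
           card {j \<in> {1, 2, 3}. x j = y} = 2}"

end

theory Submission
  imports Defs
begin

text \<open>
  Let \<open>e\<close> be the number of indices \<open>j\<close> with \<open>x\<^sub>j = y\<close>. Seven equiprobable branches are used:
  one for each \<open>j\<close> that accepts iff \<open>x\<^sub>j = y\<close>, two that accept iff
  \<open>\<bar>x\<^sub>1\<bar> + \<bar>x\<^sub>2\<bar> + \<bar>x\<^sub>3\<bar> \<noteq> 3 \<bar>y\<bar>\<close>, and two that reject. If \<open>e = 2\<close>, the sum test
  cannot be fooled and four branches accept. If \<open>e \<le> 1\<close>, at most \<open>1 + 2\<close> branches accept, and
  if \<open>e = 3\<close>, the sums agree and only three do. Hence the automaton is correct with
  probability \<open>4/7 > 21/40\<close>. A branch compares by moving head 2 one cell for every \<open>1\<close> of the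
  block under test, respectively for every third \<open>1\<close>, so that one pass over both tapes suffices;
  malformed inputs are rejected on the way.
\<close>

subsection \<open>Renaming states\<close>

text \<open>The theorem asks for \<open>nat\<close> as the state type, while the automaton is easier
  to describe over a datatype. The injection \<open>to_nat\<close> carries any countable state type
  over.\<close>

definition encode_states :: "('q::countable, 'a) automaton2 \<Rightarrow> (nat, 'a) automaton2" where
  "encode_states M = \<lparr>states = to_nat ` states M, init = to_nat (init M),
     acc = to_nat ` acc M, rej = to_nat ` rej M,
     trans = (\<lambda>q a b. map_pmf (map_prod to_nat id) (trans M (from_nat q) a b))\<rparr>"

lemma step_encode_states:
  "step (encode_states M) x y (map_prod to_nat id c) = map_pmf (map_prod to_nat id) (step M x y c)"
  by (cases c)
    (auto simp: step_def encode_states_def map_pmf_comp inj_image_mem_iff simp flip: image_Un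
      intro!: map_pmf_cong)

lemma run_encode_states:
  "run (encode_states M) x y n = map_pmf (map_prod to_nat id) (run M x y n)"
proof (induction n)
  case 0
  show ?case by (simp add: encode_states_def)
next
  case (Suc n)
  then show ?case
    by (simp add: bind_map_pmf step_encode_states map_bind_pmf del: id_apply map_prod_simp)
qed

lemma prob_2tape_automatonD:
  assumes "prob_2tape_automaton M" "q \<in> states M - (acc M \<union> rej M)"
    "(q', m1, m2) \<in> set_pmf (trans M q a b)"
  shows "q' \<in> states M \<and> (a = RightEnd \<longrightarrow> \<not> m1) \<and> (b = RightEnd \<longrightarrow> \<not> m2)"
proof -
  have "\<forall>(q', m1, m2) \<in> set_pmf (trans M q a b).
      q' \<in> states M \<and> (a = RightEnd \<longrightarrow> \<not> m1) \<and> (b = RightEnd \<longrightarrow> \<not> m2)"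
    using assms(1,2) unfolding prob_2tape_automaton_def by blast
  from bspec[OF this assms(3)] show ?thesis
    by simp
qed

lemma prob_2tape_automaton_encode_states:
  assumes "prob_2tape_automaton M"
  shows "prob_2tape_automaton (encode_states M)"
proof -
  let ?M = "encode_states M"
  have "q' \<in> states ?M \<and> (a = RightEnd \<longrightarrow> \<not> m1) \<and> (b = RightEnd \<longrightarrow> \<not> m2)"
    if q: "q \<in> states ?M - (acc ?M \<union> rej ?M)" and q': "(q', m1, m2) \<in> set_pmf (trans ?M q a b)"
    for q q' a b m1 m2
  proof -
    obtain q0 where q0: "q = to_nat q0" "q0 \<in> states M - (acc M \<union> rej M)"
      using q by (auto simp: encode_states_def)
    have "(q', m1, m2) \<in> map_prod to_nat id ` set_pmf (trans M q0 a b)"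
      using q' by (simp add: encode_states_def q0)
    then obtain q1 where q1: "q' = to_nat q1" "(q1, m1, m2) \<in> set_pmf (trans M q0 a b)"
      by force
    show ?thesis
      using prob_2tape_automatonD[OF assms q0(2) q1(2)] q1(1) by (simp add: encode_states_def)
  qed
  then have "\<forall>q \<in> states ?M - (acc ?M \<union> rej ?M). \<forall>a b. \<forall>(q', m1, m2) \<in> set_pmf (trans ?M q a b).
      q' \<in> states ?M \<and> (a = RightEnd \<longrightarrow> \<not> m1) \<and> (b = RightEnd \<longrightarrow> \<not> m2)"
    by fast
  moreover have "acc ?M \<inter> rej ?M = {}"
    using assms by (auto simp: prob_2tape_automaton_def encode_states_def)
  moreover have "finite (states ?M)" "init ?M \<in> states ?M"
    "acc ?M \<subseteq> states ?M" "rej ?M \<subseteq> states ?M"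
    using assms by (simp_all add: prob_2tape_automaton_def encode_states_def image_mono)
  ultimately show ?thesis
    by (simp only: prob_2tape_automaton_def simp_thms)
qed

lemma recognizes_encode_states:
  "recognizes (encode_states M) L p \<longleftrightarrow> recognizes M L p"
proof -
  \<comment> \<open>The renamed run is the image distribution, so its events are measured through
    preimages; injectivity makes the preimage of a renamed halting set the original one.\<close>
  have vimage: "map_prod to_nat id -` {(q, i, j). q \<in> to_nat ` A} = {(q, i, j). q \<in> A}"
    for A :: "'c::countable set"
    by (auto simp: inj_image_mem_iff)
  have "accept_prob (encode_states M) x y = accept_prob M x y"
    "reject_prob (encode_states M) x y = reject_prob M x y" for x y
    unfolding accept_prob_def reject_prob_def run_encode_states measure_map_pmf
    by (simp_all only: encode_states_def automaton2.simps vimage)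
  then show ?thesis
    by (simp add: recognizes_def)
qed

subsection \<open>The automaton\<close>

text \<open>
  In \<open>Test k b r f\<close>, \<open>k < 3\<close> is the index of the block under test and \<open>k = 3\<close> stands for the sum
  test, \<open>b\<close> is the index of the block under head 1, \<open>r\<close> counts the tested \<open>1\<close>s since
  the last move of head 2, and \<open>f\<close> records that the lengths are known to differ.
\<close>

datatype state = Start | Accept | Reject | Test nat nat nat bool

instance state :: countable
  by countable_datatype

definition active :: "nat \<Rightarrow> nat \<Rightarrow> bool" where
  "active k b \<longleftrightarrow> k = 3 \<or> k = b"

text \<open>The exchange rate: how many tested \<open>One\<close>s are matched with one cell of tape
  2.\<close>

definition unit :: "nat \<Rightarrow> nat" where
  "unit k = (if k = 3 then 3 else 1)"

text \<open>Unequal lengths show in three ways: a group of \<open>unit k\<close> tested letters is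
  completed after tape 2 has ended, tape 1 ends first, or \<open>r\<close> is nonzero at the end.
  The first two set \<open>f\<close> and reading goes on, so that a misplaced \<open>Nabla\<close>
  further right is still found. The catch-all clause includes a \<open>Nabla\<close> met on tape
  2.\<close>

fun delta :: "state \<Rightarrow> letter tape_symbol \<Rightarrow> letter tape_symbol \<Rightarrow> state \<times> bool \<times> bool" where
  "delta (Test k b r f) (Letter One) (Letter One) =
     (if \<not> active k b then (Test k b r f, True, False)
      else if Suc r = unit k then (Test k b 0 f, True, True)
      else (Test k b (Suc r) f, True, False))"
| "delta (Test k b r f) (Letter One) RightEnd =
     (if \<not> active k b then (Test k b r f, True, False)
      else if Suc r = unit k then (Test k b 0 True, True, False)
      else (Test k b (Suc r) f, True, False))"
| "delta (Test k b r f) RightEnd (Letter One) =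
     (Test k b r True, False, True)"
| "delta (Test k b r f) RightEnd RightEnd =
     (if b = 2 \<and> (\<not> f \<and> r = 0) \<noteq> (k = 3) then Accept else Reject, False, False)"
| "delta (Test k b r f) (Letter Nabla) c =
     (if b < 2 then Test k (Suc b) r f else Reject, b < 2, False)"
| "delta _ _ _ = (Reject, False, False)"

definition branch :: "nat \<Rightarrow> state" where
  "branch s = (if s < 3 then Test s 0 0 False else if s < 5 then Test 3 0 0 False else Reject)"

text \<open>All randomness lies in the first step, which also moves both heads off
  \<open>LeftEnd\<close>. Its guards against \<open>RightEnd\<close> are there because
  \<open>prob_2tape_automaton\<close> constrains the moves for every pair of symbols.\<close>

definition M2 :: "(state, letter) automaton2" where
  "M2 = \<lparr>states = {Start, Accept, Reject} \<union>
       {Test k b r f | k b r f. k \<le> 3 \<and> b \<le> 2 \<and> r < unit k},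
     init = Start, acc = {Accept}, rej = {Reject},
     trans = (\<lambda>q a c. if q = Start
       then map_pmf (\<lambda>s. (branch s, a \<noteq> RightEnd, c \<noteq> RightEnd)) (pmf_of_set {..<7})
       else return_pmf (delta q a c))\<rparr>"

lemma halting_M2: "acc M2 = {Accept}" "rej M2 = {Reject}"
  by (simp_all add: M2_def)

lemma finite_states_M2: "finite (states M2)"
proof -
  have "{Test k b r f | k b r f. k \<le> 3 \<and> b \<le> 2 \<and> r < unit k} \<subseteq>
      (\<lambda>(k, b, r, f). Test k b r f) ` ({..3} \<times> {..2} \<times> {..<3} \<times> UNIV)"
    by (force simp: unit_def split: if_splits)
  then have "finite {Test k b r f | k b r f. k \<le> 3 \<and> b \<le> 2 \<and> r < unit k}"
    by (rule finite_subset) auto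
  then show ?thesis
    by (simp add: M2_def)
qed

lemma delta_M2:
  assumes "delta q a c = (q', m1, m2)" "q \<in> states M2" "q \<noteq> Start"
  shows "q' \<in> states M2 \<and> (a = RightEnd \<longrightarrow> \<not> m1) \<and> (c = RightEnd \<longrightarrow> \<not> m2)"
  using assms
  by (cases "(q, a, c)" rule: delta.cases) (auto simp: M2_def split: if_splits)

lemma branch_M2: "branch s \<in> states M2"
  by (auto simp: branch_def M2_def unit_def)

lemma prob_2tape_automaton_M2: "prob_2tape_automaton M2"
proof -
  have "q' \<in> states M2 \<and> (a = RightEnd \<longrightarrow> \<not> m1) \<and> (c = RightEnd \<longrightarrow> \<not> m2)"
    if "q \<in> states M2" "(q', m1, m2) \<in> set_pmf (trans M2 q a c)" for q q' m1 m2 a c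
  proof (cases "q = Start")
    case True
    then show ?thesis
      using that branch_M2 by (auto simp: M2_def)
  next
    case False
    then have "delta q a c = (q', m1, m2)"
      using that by (simp add: M2_def)
    then show ?thesis
      using delta_M2 that False by blast
  qed
  moreover have "init M2 \<in> states M2" "acc M2 \<subseteq> states M2" "rej M2 \<subseteq> states M2"
    "acc M2 \<inter> rej M2 = {}"
    by (auto simp: M2_def)
  ultimately show ?thesis
    unfolding prob_2tape_automaton_def using finite_states_M2 by blast
qed

subsection \<open>Correctness of a single branch\<close>

definition next_config :: "letter list \<Rightarrow> letter list \<Rightarrow> state \<times> nat \<times> nat \<Rightarrow> state \<times> nat \<times> nat" where
  "next_config x y = (\<lambda>(q, i, j).
     if q \<in> {Accept, Reject} then (q, i, j)
     else case delta q (tape x ! i) (tape y ! j) of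
       (q', m1, m2) \<Rightarrow> (q', i + of_bool m1, j + of_bool m2))"

lemma delta_neq_Start: "fst (delta q a c) \<noteq> Start"
  by (cases "(q, a, c)" rule: delta.cases) auto

lemma step_M2:
  assumes "fst c \<noteq> Start"
  shows "step M2 x y c = return_pmf (next_config x y c)"
  using assms by (cases c) (auto simp: step_def next_config_def M2_def split: prod.splits)

lemma next_config_neq_Start: "fst c \<noteq> Start \<Longrightarrow> fst (next_config x y c) \<noteq> Start"
  using delta_neq_Start by (cases c) (auto simp: next_config_def split: prod.splits, metis fst_conv)

text \<open>\<open>Start\<close> is never entered again, so after the draw each branch is the
  iteration of a function, starting with both heads on cell 1.\<close>

lemma run_M2:
  "run M2 x y (Suc n) =
     map_pmf (\<lambda>s. (next_config x y ^^ n) (branch s, 1, 1)) (pmf_of_set {..<7})"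
proof (induction n)
  case 0
  then show ?case
    by (simp add: bind_return_pmf step_def M2_def tape_def map_pmf_comp)
next
  case (Suc n)
  have "fst ((next_config x y ^^ n) (branch s, 1, 1)) \<noteq> Start" for s
    by (induction n) (auto simp: next_config_neq_Start branch_def)
  then have "step M2 x y ((next_config x y ^^ n) (branch s, 1, 1)) =
      return_pmf ((next_config x y ^^ Suc n) (branch s, 1, 1))" for s
    by (simp add: step_M2)
  then show ?case
    unfolding run.simps(2)[of _ _ _ "Suc n"] Suc.IH
    by (simp add: bind_map_pmf) (simp add: map_pmf_def)
qed

text \<open>Expressing the scanned symbol by the unread suffix lets the invariant speak of lists
  instead of head positions. The suffix \<open>drop i x\<close> belongs to position
  \<open>Suc i\<close>, since cell 0 holds the endmarker.\<close>

definition scanned :: "'a list \<Rightarrow> 'a tape_symbol" where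
  "scanned u = (case u of [] \<Rightarrow> RightEnd | a # _ \<Rightarrow> Letter a)"

lemma scanned_eq_RightEnd [simp]: "scanned u = RightEnd \<longleftrightarrow> u = []"
  by (simp add: scanned_def split: list.split)

lemma tape_nth_Suc:
  assumes "i \<le> length x"
  shows "tape x ! Suc i = scanned (drop i x)"
proof (cases "i < length x")
  case True
  then show ?thesis
    by (simp add: tape_def scanned_def nth_append flip: Cons_nth_drop_Suc)
next
  case False
  then show ?thesis
    using assms by (simp add: tape_def scanned_def nth_append)
qed

fun tested :: "nat \<Rightarrow> nat \<Rightarrow> letter list \<Rightarrow> nat" where
  "tested k b [] = 0"
| "tested k b (One # u) = of_bool (active k b) + tested k b u"
| "tested k b (Nabla # u) = tested k (Suc b) u"

text \<open>
  The verdict that is due when \<open>u\<close> and \<open>v\<close> are the unread parts of the two tapes; it is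
  invariant under the moves of the automaton.
\<close>

fun verdict :: "state \<Rightarrow> letter list \<Rightarrow> letter list \<Rightarrow> bool" where
  "verdict (Test k b r f) u v \<longleftrightarrow> b + count_list u Nabla = 2 \<and> Nabla \<notin> set v \<and>
     (\<not> f \<and> r + tested k b u = unit k * length v) \<noteq> (k = 3)"
| "verdict q u v \<longleftrightarrow> q = Accept"

text \<open>Completing a group takes \<open>unit k\<close> off both sides of the compared equation,
  and \<open>f\<close> is set only when the equation can no longer hold. With \<open>b = 2\<close>,
  a further \<open>Nabla\<close> on tape 1 makes the block count exceed 2, in accordance with
  rejection.\<close>

lemma verdict_delta:
  assumes "delta (Test k b r f) (scanned u) (scanned v) = (q', m1, m2)" "b \<le> 2" "r < unit k"
  shows "verdict q' (drop (of_bool m1) u) (drop (of_bool m2) v) \<longleftrightarrow> verdict (Test k b r f) u v"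
proof (cases u)
  case u: Nil
  show ?thesis
  proof (cases v)
    case Nil
    moreover have "0 < unit k"
      by (simp add: unit_def)
    ultimately show ?thesis
      using assms u by (simp add: scanned_def) (auto split: if_splits)
  next
    case (Cons c v')
    \<comment> \<open>An incomplete group cannot pay for a remaining cell of tape 2, so setting
      \<open>f\<close> here is right.\<close>
    moreover have "r \<noteq> unit k + unit k * length v'"
      using assms(3) by linarith
    ultimately show ?thesis
      using assms u by (cases c) (auto simp: scanned_def)
  qed
next
  case (Cons a u')
  then show ?thesis
    using assms
    by (cases a; cases v; cases "hd v") (auto simp: scanned_def split: if_splits)
qed

lemma next_config_halted:
  "q \<in> {Accept, Reject} \<Longrightarrow> (next_config x y ^^ n) (q, i, j) = (q, i, j)"
  by (induction n) (auto simp: next_config_def)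

text \<open>Induction on the time bound: every move that does not halt reads at least one cell. The
  strict inequality leaves one step for the final decision on the two right endmarkers.\<close>

lemma branch_halts:
  assumes "q \<in> states M2 - {Start}" "i \<le> length x" "j \<le> length y"
    and "length x - i + (length y - j) < n"
  shows "fst ((next_config x y ^^ n) (q, Suc i, Suc j)) =
    (if verdict q (drop i x) (drop j y) then Accept else Reject)"
  using assms
proof (induction n arbitrary: q i j)
  case 0
  then show ?case by simp
next
  case (Suc n)
  show ?case
  proof (cases "q \<in> {Accept, Reject}")
    case True
    then show ?thesis
      by (auto simp: next_config_halted simp del: funpow.simps)
  next
    case False
    then obtain k b r f where q: "q = Test k b r f" and b: "b \<le> 2" and r: "r < unit k"
      using Suc.prems(1) by (auto simp: M2_def)
    obtain q' m1 m2 where d: "delta q (tape x ! Suc i) (tape y ! Suc j) = (q', m1, m2)"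
      by (cases "delta q (tape x ! Suc i) (tape y ! Suc j)")
    let ?i = "i + of_bool m1" and ?j = "j + of_bool m2"
    have "next_config x y (q, Suc i, Suc j) = (q', Suc ?i, Suc ?j)"
      using False d by (simp add: next_config_def)
    then have run: "(next_config x y ^^ Suc n) (q, Suc i, Suc j) =
        (next_config x y ^^ n) (q', Suc ?i, Suc ?j)"
      by (simp add: funpow_swap1)
    have q': "q' \<in> states M2 - {Start}"
      using delta_M2[OF d] delta_neq_Start[of q "tape x ! Suc i" "tape y ! Suc j"] d Suc.prems(1)
      by auto
    note tape_nth = tape_nth_Suc[OF Suc.prems(2)] tape_nth_Suc[OF Suc.prems(3)]
    have ij: "?i \<le> length x" "?j \<le> length y"
      using delta_M2[OF d] Suc.prems(1-3) by (auto simp: tape_nth of_bool_def)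
    have inv: "verdict q' (drop ?i x) (drop ?j y) \<longleftrightarrow> verdict q (drop i x) (drop j y)"
      using verdict_delta[OF d[unfolded q tape_nth] b r]
      by (simp add: q add.commute)
    show ?thesis
    proof (cases "q' \<in> {Accept, Reject}")
      case True
      then show ?thesis
        using inv unfolding run by (auto simp: next_config_halted)
    next
      case False
      then have "m1 \<or> m2"
        using d q by (cases "(q, tape x ! Suc i, tape y ! Suc j)" rule: delta.cases)
          (auto split: if_splits)
      then have "length x - ?i + (length y - ?j) < n"
        using Suc.prems(4) ij by (auto simp: of_bool_def split: if_splits)
      then show ?thesis
        unfolding run using Suc.IH[OF q' ij] inv by simp
    qed
  qed
qed

subsection \<open>Counting the accepting branches\<close>

lemma M2_prob_bounds:
  shows "accept_prob M2 x y \<ge> card {s. s < 7 \<and> verdict (branch s) x y} / 7"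
    and "reject_prob M2 x y \<ge> card {s. s < 7 \<and> \<not> verdict (branch s) x y} / 7"
proof -
  \<comment> \<open>One step for the draw, and \<open>length x + length y + 1\<close> steps in which
    every branch halts by \<open>branch_halts\<close>. The suprema are bounded below by their values
    at this time.\<close>
  let ?n = "Suc (Suc (length x + length y))"
  let ?c = "\<lambda>s. (next_config x y ^^ Suc (length x + length y)) (branch s, 1, 1)"
  have c: "fst (?c s) = (if verdict (branch s) x y then Accept else Reject)" for s
    using branch_halts[of "branch s" 0 x 0 y "Suc (length x + length y)"] branch_M2[of s]
    by (auto simp: branch_def)
  have halted: "fst (?c s) = Accept \<longleftrightarrow> verdict (branch s) x y"
    "fst (?c s) = Reject \<longleftrightarrow> \<not> verdict (branch s) x y" for s
    unfolding c by simp_all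
  have prob: "measure_pmf.prob (run M2 x y ?n) {(q, i, j). q = h} =
      card {s. s < 7 \<and> fst (?c s) = h} / 7" for h
  proof -
    have "{..<7} \<inter> ?c -` {(q, i, j). q = h} = {s. s < 7 \<and> fst (?c s) = h}"
      by force
    then show ?thesis
      unfolding run_M2 measure_map_pmf
      by (subst measure_pmf_of_set) (simp_all del: funpow.simps vimage_Collect_eq add: lessThan_empty_iff)
  qed
  have bdd: "bdd_above (range (\<lambda>n. measure_pmf.prob (run M2 x y n) A))" for A
    by (rule bdd_aboveI[of _ 1]) auto
  have "measure_pmf.prob (run M2 x y ?n) {(q, i, j). q = Accept} \<le> accept_prob M2 x y"
    unfolding accept_prob_def using cSUP_upper[OF UNIV_I bdd] by (simp only: halting_M2 singleton_iff)
  moreover have "measure_pmf.prob (run M2 x y ?n) {(q, i, j). q = Reject} \<le> reject_prob M2 x y"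
    unfolding reject_prob_def using cSUP_upper[OF UNIV_I bdd] by (simp only: halting_M2 singleton_iff)
  ultimately show "accept_prob M2 x y \<ge> card {s. s < 7 \<and> verdict (branch s) x y} / 7"
    and "reject_prob M2 x y \<ge> card {s. s < 7 \<and> \<not> verdict (branch s) x y} / 7"
    unfolding prob halted by simp_all
qed

section \<open>Block lengths and membership in \<open>L2\<close>\<close>

definition well_formed :: "letter list \<Rightarrow> letter list \<Rightarrow> bool" where
  "well_formed x y \<longleftrightarrow> count_list x Nabla = 2 \<and> Nabla \<notin> set y"

lemma lists_One_iff: "y \<in> lists {One} \<longleftrightarrow> Nabla \<notin> set y"
  by (auto simp: lists_eq_set) (metis letter.exhaust)

lemma eq_ones_iff:
  assumes "Nabla \<notin> set x" "Nabla \<notin> set y"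
  shows "x = y \<longleftrightarrow> length x = length y"
  using assms by (metis (full_types) letter.exhaust nth_equalityI nth_mem)

lemma tested_append:
  "tested k b (u @ v) = tested k b u + tested k (b + count_list u Nabla) v"
  by (induction k b u rule: tested.induct) auto

lemma tested_ones:
  "Nabla \<notin> set u \<Longrightarrow> tested k b u = (if active k b then length u else 0)"
  by (induction k b u rule: tested.induct) auto

lemma tested_blocks:
  assumes "Nabla \<notin> set u" "Nabla \<notin> set v" "Nabla \<notin> set w"
  shows "tested 0 0 (u @ [Nabla] @ v @ [Nabla] @ w) = length u"
    and "tested 1 0 (u @ [Nabla] @ v @ [Nabla] @ w) = length v"
    and "tested 2 0 (u @ [Nabla] @ v @ [Nabla] @ w) = length w"
    and "tested 3 0 (u @ [Nabla] @ v @ [Nabla] @ w) = length u + length v + length w"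
  using assms by (simp_all add: tested_append tested_ones active_def)

lemma count_list_2E:
  assumes "count_list x a = 2"
  obtains u v w where "x = u @ [a] @ v @ [a] @ w" "a \<notin> set u" "a \<notin> set v" "a \<notin> set w"
proof -
  have "a \<in> set x"
    using assms by (metis count_notin zero_neq_numeral)
  then obtain u t where x: "x = u @ a # t" "a \<notin> set u"
    by (meson split_list_first)
  then have t: "count_list t a = 1"
    using assms by simp
  then have "a \<in> set t"
    by (metis count_notin zero_neq_one)
  then obtain v w where "t = v @ a # w" "a \<notin> set v"
    by (meson split_list_first)
  moreover from this have "a \<notin> set w"
    using t by (simp add: count_list_0_iff)
  ultimately show ?thesis
    using that x by simp
qed

text \<open>On well-formed inputs this is the number \<open>e\<close> of the overview, since blocks
  over a single letter are equal iff their lengths are. Blocks are numbered from 0 here and from 1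
  in \<open>L2\<close>.\<close>

definition matches :: "letter list \<Rightarrow> letter list \<Rightarrow> nat" where
  "matches x y = (\<Sum>k<3. of_bool (tested k 0 x = length y))"

lemma L2_iff: "(x, y) \<in> L2 \<longleftrightarrow> well_formed x y \<and> matches x y = 2"
proof -
  \<comment> \<open>\<open>L2\<close> refers to some decomposition \<open>z\<close> of the first
    word; this fact makes the number of matching blocks a function of the two words alone.\<close>
  have card: "card {j \<in> {1, 2, 3}. z j = y} = matches (z 1 @ [Nabla] @ z 2 @ [Nabla] @ z 3) y"
    if z: "\<forall>j \<in> {1, 2, 3}. Nabla \<notin> set (z j)" and y: "Nabla \<notin> set y" for z :: "nat \<Rightarrow> letter list"
  proof -
    have "card {j \<in> {1, 2, 3}. z j = y} = (\<Sum>j\<in>{1, 2, 3}. of_bool (z j = y))"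
      by (simp add: Int_def)
    also have "\<dots> = (\<Sum>j\<in>{1, 2, 3}. of_bool (length (z j) = length y))"
      using z y by (intro sum.cong) (auto simp: eq_ones_iff)
    also have "\<dots> = matches (z 1 @ [Nabla] @ z 2 @ [Nabla] @ z 3) y"
      using z tested_blocks[of "z 1" "z 2" "z 3"]
      by (simp add: matches_def numeral_3_eq_3 eval_nat_numeral)
    finally show ?thesis .
  qed
  show ?thesis
  proof
    assume "(x, y) \<in> L2"
    then obtain z where z: "x = z 1 @ [Nabla] @ z 2 @ [Nabla] @ z 3"
      "\<forall>j \<in> {1, 2, 3 :: nat}. Nabla \<notin> set (z j)" "Nabla \<notin> set y" "card {j \<in> {1, 2, 3}. z j = y} = 2"
      by (auto simp: L2_def lists_One_iff)
    then show "well_formed x y \<and> matches x y = 2"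
      using card[OF z(2,3)] by (simp add: well_formed_def)
  next
    assume xy: "well_formed x y \<and> matches x y = 2"
    then obtain u v w where x: "x = u @ [Nabla] @ v @ [Nabla] @ w"
      and "Nabla \<notin> set u" "Nabla \<notin> set v" "Nabla \<notin> set w" and y: "Nabla \<notin> set y"
      unfolding well_formed_def by (metis count_list_2E)
    define z :: "nat \<Rightarrow> letter list" where "z j = (if j = 1 then u else if j = 2 then v else w)" for j
    have z: "\<forall>j \<in> {1, 2, 3}. Nabla \<notin> set (z j)" "x = z 1 @ [Nabla] @ z 2 @ [Nabla] @ z 3"
      using x \<open>Nabla \<notin> set u\<close> \<open>Nabla \<notin> set v\<close> \<open>Nabla \<notin> set w\<close> by (simp_all add: z_def)
    then have "card {j \<in> {1, 2, 3}. z j = y} = 2"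
      using card[OF z(1) y] xy by simp
    then show "(x, y) \<in> L2"
      unfolding L2_def lists_One_iff using z y by blast
  qed
qed

section \<open>Number of accepting branches inside and outside \<open>L2\<close>\<close>

lemma verdict_branch:
  "verdict (branch s) x y \<longleftrightarrow> well_formed x y \<and>
     (if s < 3 then tested s 0 x = length y else s < 5 \<and> tested 3 0 x \<noteq> 3 * length y)"
  by (auto simp: branch_def well_formed_def unit_def)

text \<open>Branches 0 to 2 contribute \<open>matches x y\<close>, branches 3 and 4 run the same sum
  test, and branches 5 and 6 never accept.\<close>

lemma card_accepting:
  assumes "well_formed x y"
  shows "card {s. s < 7 \<and> verdict (branch s) x y} =
    matches x y + 2 * of_bool (tested 3 0 x \<noteq> 3 * length y)"
proof -
  have "card {s. s < 7 \<and> verdict (branch s) x y} = (\<Sum>s<7. of_bool (verdict (branch s) x y))"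
    by (simp add: Int_def)
  then show ?thesis
    using assms unfolding verdict_branch matches_def by (simp add: eval_nat_numeral)
qed

lemma card_rejecting:
  "card {s. s < 7 \<and> \<not> verdict (branch s) x y} = 7 - card {s. s < 7 \<and> verdict (branch s) x y}"
proof -
  have "{s. s < 7 \<and> \<not> verdict (branch s) x y} = {..<7} - {s. s < 7 \<and> verdict (branch s) x y}"
    by auto
  then show ?thesis
    by (simp add: card_Diff_subset subset_eq)
qed

lemma tested_sum:
  assumes "well_formed x y"
  shows "tested 3 0 x = (\<Sum>k<3. tested k 0 x)"
proof -
  obtain u v w where "x = u @ [Nabla] @ v @ [Nabla] @ w"
    "Nabla \<notin> set u" "Nabla \<notin> set v" "Nabla \<notin> set w"
    using assms unfolding well_formed_def by (metis count_list_2E)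
  then show ?thesis
    using tested_blocks[of u v w] by (simp add: numeral_3_eq_3 eval_nat_numeral)
qed

lemma sum_lessThan_3: "(\<Sum>k<3. g k) = g 0 + g 1 + g (2::nat)" for g :: "nat \<Rightarrow> nat"
  by (simp add: eval_nat_numeral)

text \<open>With two lengths equal to \<open>n\<close>, the sum deviates from \<open>3 * n\<close>
  by exactly as much as the third length deviates from \<open>n\<close>.\<close>

lemma matches_2_sum_neq:
  assumes "well_formed x y" "matches x y = 2"
  shows "tested 3 0 x \<noteq> 3 * length y"
proof -
  have "a + b + c \<noteq> 3 * n" if "of_bool (a = n) + of_bool (b = n) + of_bool (c = n) = (2 :: nat)"
    for a b c n :: nat
    using that by (cases "a = n"; cases "b = n"; cases "c = n") simp_all
  from this[of "tested 0 0 x" "length y" "tested 1 0 x" "tested 2 0 x"] show ?thesis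
    using assms(2) unfolding tested_sum[OF assms(1)] matches_def sum_lessThan_3 by blast
qed

text \<open>The two extreme cases give 3 each: one match with the sum test accepting, and three
  matches, which force the sums to agree.\<close>

lemma matches_neq_2_le:
  assumes "well_formed x y" "matches x y \<noteq> 2"
  shows "matches x y + 2 * of_bool (tested 3 0 x \<noteq> 3 * length y) \<le> 3"
proof -
  have "of_bool (a = n) + of_bool (b = n) + of_bool (c = n) + 2 * of_bool (a + b + c \<noteq> 3 * n) \<le> (3 :: nat)"
    if "of_bool (a = n) + of_bool (b = n) + of_bool (c = n) \<noteq> (2 :: nat)" for a b c n :: nat
    using that by (cases "a = n"; cases "b = n"; cases "c = n") simp_all
  from this[of "tested 0 0 x" "length y" "tested 1 0 x" "tested 2 0 x"] show ?thesis
    using assms(2) unfolding tested_sum[OF assms(1)] matches_def sum_lessThan_3 by blast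
qed

lemma recognizes_M2: "recognizes M2 L2 (4 / 7)"
  unfolding recognizes_def
proof (intro allI conjI impI)
  fix x y
  assume "(x, y) \<in> L2"
  then have wf: "well_formed x y" and two: "matches x y = 2"
    by (simp_all add: L2_iff)
  have "tested 3 0 x \<noteq> 3 * length y"
    using matches_2_sum_neq[OF wf two] .
  then have "card {s. s < 7 \<and> verdict (branch s) x y} = 4"
    using card_accepting[OF wf] two by simp
  then show "4 / 7 \<le> accept_prob M2 x y"
    using M2_prob_bounds(1)[of x y] by simp
next
  fix x y
  assume notin: "(x, y) \<notin> L2"
  have "card {s. s < 7 \<and> verdict (branch s) x y} \<le> 3"
  proof (cases "well_formed x y")
    case True
    then have "matches x y \<noteq> 2"
      using notin by (simp add: L2_iff)
    then have "matches x y + 2 * of_bool (tested 3 0 x \<noteq> 3 * length y) \<le> 3"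
      by (rule matches_neq_2_le[OF True])
    then show ?thesis
      by (simp add: card_accepting[OF True])
  \<comment> \<open>On a malformed input no branch accepts.\<close>
  qed (simp add: verdict_branch)
  then have "real (card {s. s < 7 \<and> \<not> verdict (branch s) x y}) \<ge> 4"
    unfolding card_rejecting by linarith
  then show "4 / 7 \<le> reject_prob M2 x y"
    using M2_prob_bounds(2)[of x y] by simp
qed

lemma recognizes_mono:
  assumes "recognizes M L p" "p' \<le> p"
  shows "recognizes M L p'"
  using assms unfolding recognizes_def by (meson order_trans)

theorem theorem3p4:
  "\<exists>M :: (nat, letter) automaton2. prob_2tape_automaton M \<and> recognizes M L2 (21 / 40)"
proof (intro exI conjI)
  show "prob_2tape_automaton (encode_states M2)"
    by (rule prob_2tape_automaton_encode_states[OF prob_2tape_automaton_M2])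
  show "recognizes (encode_states M2) L2 (21 / 40)"
    \<comment> \<open>\<open>21 / 40 \<le> 4 / 7\<close> because 21 * 7 = 147 and 4 * 40 =
      160.\<close>
    unfolding recognizes_encode_states by (rule recognizes_mono[OF recognizes_M2]) simp
qed

end
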